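(* For every non-empty bounded convex open set $\Omega\subset\mathbb{R}^n$ and all $p,q\in\Omega$, one has $$d_\Omega(p,q)=d_H(p,q).$$
   Context: Let $\Omega\subset\mathbb{R}^n$ be a non-empty bounded convex open set. For $p,q\in\Omega$, let $$m(p,q)=\inf\{\lambda>0\ :\ \Omega-q\subset\lambda(\Omega-p)\},$$ where $\Omega-p=\{x-p: x\in\Omega\}$, and define $d_\Omega(p,q)=\log m(p,q)+\log m(q,p)$. Hilbert metric: for distinct $p,q\in\Omega$, let $r,s$ be the two intersection points of the line through $p$ and $q$ with $\partial\Omega$, labelled so that $r,p,q,s$ occur in this order on the line; then $$d_H(p,q)=\log\frac{|q-r|\,|s-p|}{|p-r|\,|s-q|},$$ and $d_H(p,p)=0$. *)

theory Defs
  imports "HOL-Analysis.Analysis"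
begin

definition translate_to :: "'a::euclidean_space set \<Rightarrow> 'a \<Rightarrow> 'a set" where
  "translate_to \<Omega> p = (\<lambda>x. x - p) ` \<Omega>"

definition dilation_bound :: "'a::euclidean_space set \<Rightarrow> 'a \<Rightarrow> 'a \<Rightarrow> real" where
  "dilation_bound \<Omega> p q =
     Inf {l. l > 0 \<and> translate_to \<Omega> q \<subseteq> (\<lambda>x. l *\<^sub>R x) ` translate_to \<Omega> p}"

definition d_dilation :: "'a::euclidean_space set \<Rightarrow> 'a \<Rightarrow> 'a \<Rightarrow> real" where
  "d_dilation \<Omega> p q = ln (dilation_bound \<Omega> p q) + ln (dilation_bound \<Omega> q p)"

(* The two betweenness conditions say that r, p, q, s occur in this order on the line
   through the distinct points p and q. They determine r and s uniquely when \<Omega> is bounded,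
   convex and open and contains p and q; otherwise the value may be unspecified. *)
definition chord_ends :: "'a::euclidean_space set \<Rightarrow> 'a \<Rightarrow> 'a \<Rightarrow> 'a \<times> 'a" where
  "chord_ends \<Omega> p q =
     (THE (r, s). affine hull {p, q} \<inter> frontier \<Omega> = {r, s}
        \<and> between (r, q) p \<and> between (p, s) q)"

definition d_hilbert :: "'a::euclidean_space set \<Rightarrow> 'a \<Rightarrow> 'a \<Rightarrow> real" where
  "d_hilbert \<Omega> p q =
     (if p = q then 0
      else let (r, s) = chord_ends \<Omega> p q
           in ln ((norm (q - r) * norm (s - p)) / (norm (p - r) * norm (s - q))))"

end

theory Submission
  imports Defs
begin

text \<open>
  Let \<open>r\<close> be the boundary point on the ray from \<open>q\<close> through \<open>p\<close>, and \<open>q - r = l (p - r)\<close>, so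
  \<open>l \<ge> 1\<close>. The inclusion \<open>\<Omega> - q \<subseteq> l (\<Omega> - p)\<close> says that the homothety with centre \<open>r\<close> and ratio
  \<open>1 / l\<close> maps \<open>\<Omega>\<close> into itself, which holds by convexity because \<open>r\<close> lies in the closure. A smaller
  factor would put a closure point strictly beyond \<open>r\<close> as seen from \<open>p\<close>, making \<open>r\<close> interior.
  Hence \<open>m(p,q) = l = |q - r| / |p - r|\<close>; exchanging the roles of \<open>p\<close> and \<open>q\<close> gives
  \<open>m(q,p) = |p - s| / |q - s|\<close>.
\<close>

text \<open>Solving \<open>x - q = l *\<^sub>R (y - p)\<close> for \<open>y\<close> turns the
  inclusion into invariance of \<open>\<Omega>\<close> under the affine map of ratio
  \<open>1 / l\<close> that sends \<open>q\<close> to \<open>p\<close>.\<close>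

lemma translate_to_subset_scaled_iff:
  assumes "l > 0"
  shows "translate_to \<Omega> q \<subseteq> (\<lambda>x. l *\<^sub>R x) ` translate_to \<Omega> p
    \<longleftrightarrow> (\<forall>x\<in>\<Omega>. p + (x - q) /\<^sub>R l \<in> \<Omega>)"
proof -
  have "x - q \<in> (\<lambda>x. l *\<^sub>R x) ` translate_to \<Omega> p \<longleftrightarrow> p + (x - q) /\<^sub>R l \<in> \<Omega>" for x
  proof
    assume "x - q \<in> (\<lambda>x. l *\<^sub>R x) ` translate_to \<Omega> p"
    then obtain y where "y \<in> \<Omega>" "x - q = l *\<^sub>R (y - p)"
      by (auto simp: translate_to_def)
    then show "p + (x - q) /\<^sub>R l \<in> \<Omega>"
      using assms by simp
  next
    assume "p + (x - q) /\<^sub>R l \<in> \<Omega>"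
    moreover have "x - q = l *\<^sub>R ((p + (x - q) /\<^sub>R l) - p)"
      using assms by simp
    ultimately show "x - q \<in> (\<lambda>x. l *\<^sub>R x) ` translate_to \<Omega> p"
      unfolding translate_to_def by blast
  qed
  moreover have "translate_to \<Omega> q \<subseteq> X \<longleftrightarrow> (\<forall>x\<in>\<Omega>. x - q \<in> X)" for X
    by (auto simp: translate_to_def)
  ultimately show ?thesis
    by simp
qed

text \<open>For \<open>t > 1\<close> the point \<open>r\<close> would lie strictly between the
  interior point \<open>c\<close> and a point of the closure, hence be interior by
  convexity.\<close>

lemma closure_beyond_frontier:
  fixes \<Omega> :: "'a::euclidean_space set"
  assumes "convex \<Omega>" "c \<in> interior \<Omega>" "r \<in> frontier \<Omega>" "c + t *\<^sub>R (r - c) \<in> closure \<Omega>"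
  shows "t \<le> 1"
proof (rule ccontr)
  assume "\<not> t \<le> 1"
  then have t: "t > 1" by simp
  let ?y = "c + t *\<^sub>R (r - c)"
  have "?y - (1 - 1 / t) *\<^sub>R (?y - c) \<in> interior \<Omega>"
    using assms t by (intro mem_interior_closure_convex_shrink) auto
  moreover have "?y - (1 - 1 / t) *\<^sub>R (?y - c) = r"
    using t by (simp add: algebra_simps)
  ultimately show False
    using assms(3) by (simp add: frontier_def)
qed

lemma dilation_bound_eq:
  fixes \<Omega> :: "'a::euclidean_space set"
  assumes "convex \<Omega>" "open \<Omega>" "p \<in> \<Omega>" "r \<in> frontier \<Omega>"
    and l: "l \<ge> 1" "q - r = l *\<^sub>R (p - r)"
  shows "dilation_bound \<Omega> p q = l"
  unfolding dilation_bound_def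
proof (rule cInf_eq_minimum)
  have r: "r \<in> closure \<Omega>"
    using assms(4) by (simp add: frontier_def)
  have "p + (x - q) /\<^sub>R l \<in> \<Omega>" if "x \<in> \<Omega>" for x
  proof -
    \<comment> \<open>The homothety image of \<open>x\<close>; since \<open>l \<ge> 1\<close>, it
      lies on the segment from \<open>r\<close> to the interior point \<open>x\<close>, with
      \<open>r\<close> excluded.\<close>
    have "r - (1 / l) *\<^sub>R (r - x) \<in> interior \<Omega>"
      using assms r that by (intro mem_interior_closure_convex_shrink) (auto simp: interior_open)
    moreover have "(x - q) /\<^sub>R l = (x - r) /\<^sub>R l - (q - r) /\<^sub>R l"
      by (simp flip: scaleR_diff_right)
    then have "(x - q) /\<^sub>R l = (x - r) /\<^sub>R l - (p - r)"
      using l(1) unfolding l(2) by simp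
    then have "r - (1 / l) *\<^sub>R (r - x) = p + (x - q) /\<^sub>R l"
      by (simp add: algebra_simps inverse_eq_divide)
    ultimately show ?thesis
      using interior_subset by auto
  qed
  then show "l \<in> {l. l > 0 \<and> translate_to \<Omega> q \<subseteq> (\<lambda>x. l *\<^sub>R x) ` translate_to \<Omega> p}"
    using l(1) by (simp add: translate_to_subset_scaled_iff)
next
  fix k
  assume "k \<in> {l. l > 0 \<and> translate_to \<Omega> q \<subseteq> (\<lambda>x. l *\<^sub>R x) ` translate_to \<Omega> p}"
  then have k: "k > 0" "\<forall>x\<in>\<Omega>. p + (x - q) /\<^sub>R k \<in> \<Omega>"
    by (auto simp: translate_to_subset_scaled_iff)
  \<comment> \<open>By continuity the invariance extends to the closure, so the map may be applied
    to the boundary point \<open>r\<close>.\<close>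
  have "(\<lambda>x. p + (x - q) /\<^sub>R k) ` closure \<Omega> \<subseteq> closure \<Omega>"
    using k(2) closure_subset[of \<Omega>]
    by (intro image_closure_subset) (auto intro!: continuous_intros)
  then have "p + (r - q) /\<^sub>R k \<in> closure \<Omega>"
    using assms(4) by (auto simp: frontier_def)
  moreover have "r - q = l *\<^sub>R (r - p)"
    using l(2) by (metis minus_diff_eq scaleR_minus_right)
  then have "(r - q) /\<^sub>R k = (l / k) *\<^sub>R (r - p)"
    by (simp add: inverse_eq_divide)
  ultimately have "l / k \<le> 1"
    using assms by (intro closure_beyond_frontier[of \<Omega> p r]) (auto simp: interior_open)
  then show "l \<le> k"
    using k(1) by simp
qed

text \<open>In the parametrization \<open>L\<close> of the line with \<open>p\<close> at 0 and
  \<open>q\<close> at 1, the two end points sit at \<open>- a\<close> and \<open>1 + b\<close>, and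
  betweenness becomes the order of the parameters.\<close>

lemma chord_ends_eq:
  fixes \<Omega> :: "'a::euclidean_space set"
  assumes "convex \<Omega>" "open \<Omega>" "p \<in> \<Omega>" "q \<in> \<Omega>" "p \<noteq> q"
    and a: "a > 0" "p + a *\<^sub>R (p - q) \<in> frontier \<Omega>"
    and b: "b > 0" "q + b *\<^sub>R (q - p) \<in> frontier \<Omega>"
  shows "chord_ends \<Omega> p q = (p + a *\<^sub>R (p - q), q + b *\<^sub>R (q - p))"
proof -
  define L where "L t = p + t *\<^sub>R (q - p)" for t
  have inj: "L t = L u \<longleftrightarrow> t = u" for t u
    using \<open>p \<noteq> q\<close> by (simp add: L_def)
  have pq: "p = L 0" "q = L 1"
    by (simp_all add: L_def)
  have r: "p + a *\<^sub>R (p - q) = L (- a)" and s: "q + b *\<^sub>R (q - p) = L (1 + b)"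
    by (simp_all add: L_def algebra_simps)
  have betw: "between (L t, L u) (L v) \<longleftrightarrow> (t \<le> v \<and> v \<le> u \<or> u \<le> v \<and> v \<le> t)" for t u v
  proof -
    have dist: "dist (L t) (L u) = norm (q - p) * \<bar>t - u\<bar>" for t u
      by (simp add: L_def dist_norm flip: scaleR_diff_left)
    have "between (L t, L u) (L v) \<longleftrightarrow>
        norm (q - p) * \<bar>t - u\<bar> = norm (q - p) * (\<bar>t - v\<bar> + \<bar>v - u\<bar>)"
      by (simp add: between dist distrib_left)
    also have "\<dots> \<longleftrightarrow> \<bar>t - u\<bar> = \<bar>t - v\<bar> + \<bar>v - u\<bar>"
      using \<open>p \<noteq> q\<close> by simp
    finally show ?thesis by linarith
  qed
  have hull: "affine hull {p, q} = range L"
    by (auto simp: affine_hull_2_alt L_def)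
  have int: "p \<in> interior \<Omega>" "q \<in> interior \<Omega>"
    using assms by (simp_all add: interior_open)
  \<comment> \<open>The lower bound comes from looking from \<open>p\<close> towards the end at
    \<open>- a\<close>, the upper one from looking from \<open>q\<close> towards the end at
    \<open>1 + b\<close>.\<close>
  have bounds: "- a \<le> t \<and> t \<le> 1 + b" if "L t \<in> closure \<Omega>" for t
  proof
    have "p + (- t / a) *\<^sub>R (p + a *\<^sub>R (p - q) - p) = L t"
      using a(1) by (simp add: L_def algebra_simps)
    then have "- t / a \<le> 1"
      using closure_beyond_frontier[OF assms(1) int(1) a(2), of "- t / a"] that by simp
    then show "- a \<le> t"
      using a(1) by (simp add: field_simps)
    have "q + ((t - 1) / b) *\<^sub>R (q + b *\<^sub>R (q - p) - q) = L t"
      using b(1) by (simp add: L_def) (simp add: algebra_simps)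
    then have "(t - 1) / b \<le> 1"
      using closure_beyond_frontier[OF assms(1) int(2) b(2), of "(t - 1) / b"] that by simp
    then show "t \<le> 1 + b"
      using b(1) by (simp add: field_simps)
  qed
  have ends: "t = - a \<or> t = 1 + b" if "L t \<in> frontier \<Omega>" for t
  proof (rule ccontr)
    assume neq: "\<not> (t = - a \<or> t = 1 + b)"
    have clo: "L t \<in> closure \<Omega>"
      using that by (simp add: frontier_def)
    have t: "- a < t" "t < 1 + b"
      using bounds[OF clo] neq by auto
    \<comment> \<open>\<open>x\<close> is the end of the chord on the same side of \<open>p\<close>
      as \<open>L t\<close>, and \<open>e\<close> is the weight of \<open>p\<close> when
      \<open>L t\<close> is written as a convex combination of \<open>x\<close> and
      \<open>p\<close>. It is positive, so \<open>L t\<close> is interior.\<close>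
    define x where "x = (if t \<le> 0 then L (- a) else L (1 + b))"
    define e where "e = (if t \<le> 0 then (t + a) / a else 1 - t / (1 + b))"
    have "x - e *\<^sub>R (x - p) \<in> interior \<Omega>"
      using assms(1) int(1) a b t
      by (intro mem_interior_closure_convex_shrink)
         (auto simp: x_def e_def frontier_def divide_simps simp flip: r s)
    moreover have "(1 - e) *\<^sub>R (x - p) = t *\<^sub>R (q - p)"
      using a(1) b(1) by (simp add: x_def e_def L_def diff_divide_distrib add_divide_distrib)
    then have "x - e *\<^sub>R (x - p) = L t"
      by (simp add: L_def algebra_simps)
    ultimately show False
      using that by (simp add: frontier_def)
  qed
  have chord: "affine hull {p, q} \<inter> frontier \<Omega> = {L (- a), L (1 + b)}"
    using a(2) b(2) ends unfolding hull r s by auto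
  show ?thesis
    unfolding chord_ends_def chord r s
  proof (rule the_equality)
    show "case (L (- a), L (1 + b)) of (r, s) \<Rightarrow>
        {L (- a), L (1 + b)} = {r, s} \<and> between (r, q) p \<and> between (p, s) q"
      using a(1) b(1) by (simp add: pq(1) pq(2) betw)
  next
    fix z
    assume "case z of (r, s) \<Rightarrow>
        {L (- a), L (1 + b)} = {r, s} \<and> between (r, q) p \<and> between (p, s) q"
    then obtain r' s' where z: "z = (r', s')" "{L (- a), L (1 + b)} = {r', s'}"
      "between (r', L 1) (L 0)"
      by (auto simp flip: pq)
    \<comment> \<open>This excludes the swapped labelling: 0 does not lie between
      \<open>1 + b\<close> and 1.\<close>
    have "r' \<noteq> L (1 + b)"
      using z(3) b(1) by (auto simp: betw)
    then show "z = (L (- a), L (1 + b))"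
      using z(1,2) by (auto simp: doubleton_eq_iff)
  qed
qed

text \<open>For \<open>q = p\<close> every frontier point serves as \<open>r\<close> with ratio 1;
  boundedness guarantees that one exists.\<close>

lemma dilation_bound_self:
  fixes \<Omega> :: "'a::euclidean_space set"
  assumes "bounded \<Omega>" "convex \<Omega>" "open \<Omega>" "p \<in> \<Omega>"
  shows "dilation_bound \<Omega> p p = 1"
proof -
  have "frontier \<Omega> \<noteq> {}"
    using assms not_bounded_UNIV by (intro frontier_not_empty) auto
  then show ?thesis
    using dilation_bound_eq[OF assms(2-4), of _ 1 p] by auto
qed

lemma dilation_bound_ray:
  fixes \<Omega> :: "'a::euclidean_space set"
  assumes "convex \<Omega>" "open \<Omega>" "p \<in> \<Omega>" "p \<noteq> q"
    and a: "a > 0" "p + a *\<^sub>R (p - q) \<in> frontier \<Omega>"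
  defines "r \<equiv> p + a *\<^sub>R (p - q)"
  shows "dilation_bound \<Omega> p q = norm (q - r) / norm (p - r)"
proof -
  \<comment> \<open>Both differences are multiples of \<open>q - p\<close>, with factors
    \<open>1 + a\<close> and \<open>a\<close>.\<close>
  have qr: "q - r = ((1 + a) / a) *\<^sub>R (p - r)"
    using a(1) by (simp add: r_def algebra_simps add_divide_distrib)
  have "dilation_bound \<Omega> p q = (1 + a) / a"
    using assms qr by (intro dilation_bound_eq) auto
  moreover have "p - r \<noteq> 0"
    using a(1) \<open>p \<noteq> q\<close> by (simp add: r_def)
  ultimately show ?thesis
    using a(1) by (simp add: qr)
qed

theorem proposition2p1:
  fixes \<Omega> :: "(real ^ 'n) set" and p q :: "real ^ 'n"
  assumes "\<Omega> \<noteq> {}" and "bounded \<Omega>" and "convex \<Omega>" and "open \<Omega>"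
    and "p \<in> \<Omega>" and "q \<in> \<Omega>"
  shows "d_dilation \<Omega> p q = d_hilbert \<Omega> p q"
proof (cases "p = q")
  case True
  then show ?thesis
    using assms by (simp add: d_dilation_def d_hilbert_def dilation_bound_self)
next
  case False
  obtain a where a: "a > 0" "p + a *\<^sub>R (p - q) \<in> frontier \<Omega>"
    using ray_to_frontier[of \<Omega> p "p - q"] assms False by (auto simp: interior_open)
  obtain b where b: "b > 0" "q + b *\<^sub>R (q - p) \<in> frontier \<Omega>"
    using ray_to_frontier[of \<Omega> q "q - p"] assms False by (auto simp: interior_open)
  define r s where "r = p + a *\<^sub>R (p - q)" and "s = q + b *\<^sub>R (q - p)"
  have ends: "chord_ends \<Omega> p q = (r, s)"
    unfolding r_def s_def using assms False a b by (intro chord_ends_eq)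
  have "dilation_bound \<Omega> p q = norm (q - r) / norm (p - r)"
    unfolding r_def using assms False a by (intro dilation_bound_ray)
  moreover have "dilation_bound \<Omega> q p = norm (s - p) / norm (s - q)"
    using dilation_bound_ray[of \<Omega> q p b] assms False b by (simp add: s_def norm_minus_commute)
  \<comment> \<open>All four norms must be nonzero for the logarithm of the cross-ratio to split
    into a sum.\<close>
  moreover have "r \<noteq> p" "s \<noteq> q" "r \<noteq> q" "s \<noteq> p"
  proof -
    have "r - p = a *\<^sub>R (p - q)" "s - q = b *\<^sub>R (q - p)"
      "r - q = (1 + a) *\<^sub>R (p - q)" "s - p = (1 + b) *\<^sub>R (q - p)"
      by (simp_all add: r_def s_def algebra_simps)
    then show "r \<noteq> p" "s \<noteq> q" "r \<noteq> q" "s \<noteq> p"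
      using a(1) b(1) False by (auto simp: add_nonneg_eq_0_iff)
  qed
  ultimately show ?thesis
    using False by (simp add: d_dilation_def d_hilbert_def ends ln_mult ln_div)
qed

end
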